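(* Let $\mathfrak{g},\tilde{\mathfrak{g}}$ be finite dimensional Lie algebras over $\mathbb{F}\in\{\mathbb{R},\mathbb{C}\}$ with $\tilde{\mathfrak g}$ simple, and let $\sigma\in\mathrm{Aut}\,\mathfrak g$, $\tilde\sigma\in\mathrm{Aut}\,\tilde{\mathfrak g}$. Let $\varphi:L(\mathfrak g,\sigma)\to L(\tilde{\mathfrak g},\tilde\sigma)$ be a surjective homomorphism of Lie algebras (only assumed $\mathbb{F}$-linear and bracket preserving, no continuity). Then $\varphi$ is standard.
   Context: For a finite dimensional Lie algebra $\mathfrak g$ over $\mathbb F$ and $\sigma\in\mathrm{Aut}\,\mathfrak g$ (not necessarily of finite order), the twisted loop algebra is $L(\mathfrak g,\sigma)=\{u:\mathbb{R}\to\mathfrak g \text{ smooth}\mid u(t+2\pi)=\sigma u(t)\ \forall t\}$ with pointwise bracket $[u,v]_0(t)=[u(t),v(t)]$. A homomorphism $\varphi:L(\mathfrak g,\sigma)\to L(\tilde{\mathfrak g},\tilde\sigma)$ is called standard if there exist a smooth function $\lambda:\mathbb{R}\to\mathbb{R}$ and Lie algebra homomorphisms $\varphi_t:\mathfrak g\to\tilde{\mathfrak g}$ depending smoothly on $t\in\mathbb R$ such that $(\varphi u)(t)=\varphi_t(u(\lambda(t)))$ for all $u$ and $t$. *)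

theory Defs
  imports "HOL-Analysis.Analysis"
begin

definition vderiv :: "(real \<Rightarrow> 'a::real_normed_vector) \<Rightarrow> real \<Rightarrow> 'a" where
  "vderiv f = (\<lambda>t. vector_derivative f (at t))"

definition smooth_fun :: "(real \<Rightarrow> 'a::real_normed_vector) \<Rightarrow> bool" where
  "smooth_fun f \<longleftrightarrow> (\<forall>n t. ((vderiv ^^ n) f) differentiable (at t))"

definition lie_algebra :: "('k::field \<Rightarrow> 'a \<Rightarrow> 'a::ab_group_add) \<Rightarrow> ('a \<Rightarrow> 'a \<Rightarrow> 'a) \<Rightarrow> bool" where
  "lie_algebra sc br \<longleftrightarrow> vector_space sc
     \<and> (\<forall>x y z. br (x + y) z = br x z + br y z)
     \<and> (\<forall>x y z. br x (y + z) = br x y + br x z)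
     \<and> (\<forall>c x y. br (sc c x) y = sc c (br x y))
     \<and> (\<forall>c x y. br x (sc c y) = sc c (br x y))
     \<and> (\<forall>x. br x x = 0)
     \<and> (\<forall>x y z. br x (br y z) + br y (br z x) + br z (br x y) = 0)"

definition lie_hom :: "('k::field \<Rightarrow> 'a \<Rightarrow> 'a::ab_group_add) \<Rightarrow> ('a \<Rightarrow> 'a \<Rightarrow> 'a)
     \<Rightarrow> ('k \<Rightarrow> 'b \<Rightarrow> 'b::ab_group_add) \<Rightarrow> ('b \<Rightarrow> 'b \<Rightarrow> 'b) \<Rightarrow> ('a \<Rightarrow> 'b) \<Rightarrow> bool" where
  "lie_hom sc1 br1 sc2 br2 f \<longleftrightarrow> Vector_Spaces.linear sc1 sc2 f
     \<and> (\<forall>x y. f (br1 x y) = br2 (f x) (f y))"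

definition lie_aut :: "('k::field \<Rightarrow> 'a \<Rightarrow> 'a::ab_group_add) \<Rightarrow> ('a \<Rightarrow> 'a \<Rightarrow> 'a) \<Rightarrow> ('a \<Rightarrow> 'a) \<Rightarrow> bool" where
  "lie_aut sc br f \<longleftrightarrow> lie_hom sc br sc br f \<and> bij f"

definition lie_ideal :: "('k::field \<Rightarrow> 'a \<Rightarrow> 'a::ab_group_add) \<Rightarrow> ('a \<Rightarrow> 'a \<Rightarrow> 'a) \<Rightarrow> 'a set \<Rightarrow> bool" where
  "lie_ideal sc br I \<longleftrightarrow> module.subspace sc I \<and> (\<forall>x\<in>I. \<forall>y. br y x \<in> I)"

definition simple_lie :: "('k::field \<Rightarrow> 'a \<Rightarrow> 'a::ab_group_add) \<Rightarrow> ('a \<Rightarrow> 'a \<Rightarrow> 'a) \<Rightarrow> bool" where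
  "simple_lie sc br \<longleftrightarrow> (\<exists>x y. br x y \<noteq> 0)
     \<and> (\<forall>I. lie_ideal sc br I \<longrightarrow> I = {0} \<or> I = UNIV)"

definition loop_alg :: "('a::real_normed_vector \<Rightarrow> 'a) \<Rightarrow> (real \<Rightarrow> 'a) set" where
  "loop_alg \<sigma> = {u. smooth_fun u \<and> (\<forall>t. u (t + 2 * pi) = \<sigma> (u t))}"

definition loop_hom ::
  "('k::field \<Rightarrow> 'a \<Rightarrow> 'a::real_normed_vector) \<Rightarrow> ('a \<Rightarrow> 'a \<Rightarrow> 'a) \<Rightarrow> ('a \<Rightarrow> 'a)
   \<Rightarrow> ('k \<Rightarrow> 'b \<Rightarrow> 'b::real_normed_vector) \<Rightarrow> ('b \<Rightarrow> 'b \<Rightarrow> 'b) \<Rightarrow> ('b \<Rightarrow> 'b)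
   \<Rightarrow> ((real \<Rightarrow> 'a) \<Rightarrow> (real \<Rightarrow> 'b)) \<Rightarrow> bool" where
  "loop_hom sc1 br1 \<sigma>1 sc2 br2 \<sigma>2 \<phi> \<longleftrightarrow>
     (\<forall>u\<in>loop_alg \<sigma>1. \<phi> u \<in> loop_alg \<sigma>2)
   \<and> (\<forall>u\<in>loop_alg \<sigma>1. \<forall>v\<in>loop_alg \<sigma>1. \<phi> (\<lambda>t. u t + v t) = (\<lambda>t. \<phi> u t + \<phi> v t))
   \<and> (\<forall>c. \<forall>u\<in>loop_alg \<sigma>1. \<phi> (\<lambda>t. sc1 c (u t)) = (\<lambda>t. sc2 c (\<phi> u t)))
   \<and> (\<forall>u\<in>loop_alg \<sigma>1. \<forall>v\<in>loop_alg \<sigma>1.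
        \<phi> (\<lambda>t. br1 (u t) (v t)) = (\<lambda>t. br2 (\<phi> u t) (\<phi> v t)))"

text \<open>Standard homomorphisms: (phi u)(t) = phi_t (u (lambda t)) with lambda smooth and
  phi_t Lie algebra homomorphisms depending smoothly on t (for linear maps between
  finite dimensional spaces, smooth dependence is equivalent to smoothness of
  t \<mapsto> phi_t x for every x).\<close>
definition standard_hom ::
  "('k::field \<Rightarrow> 'a \<Rightarrow> 'a::real_normed_vector) \<Rightarrow> ('a \<Rightarrow> 'a \<Rightarrow> 'a) \<Rightarrow> ('a \<Rightarrow> 'a)
   \<Rightarrow> ('k \<Rightarrow> 'b \<Rightarrow> 'b::real_normed_vector) \<Rightarrow> ('b \<Rightarrow> 'b \<Rightarrow> 'b)
   \<Rightarrow> ((real \<Rightarrow> 'a) \<Rightarrow> (real \<Rightarrow> 'b)) \<Rightarrow> bool" where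
  "standard_hom sc1 br1 \<sigma>1 sc2 br2 \<phi> \<longleftrightarrow>
     (\<exists>(lam :: real \<Rightarrow> real) (\<Phi> :: real \<Rightarrow> 'a \<Rightarrow> 'b).
        smooth_fun lam
      \<and> (\<forall>t. lie_hom sc1 br1 sc2 br2 (\<Phi> t))
      \<and> (\<forall>x. smooth_fun (\<lambda>t. \<Phi> t x))
      \<and> (\<forall>u\<in>loop_alg \<sigma>1. \<forall>t. \<phi> u t = \<Phi> t (u (lam t))))"

end

theory Submission
  imports Defs
begin

text \<open>
  Fix \<open>t\<close> and compose \<open>\<phi>\<close> with evaluation at \<open>t\<close>; this gives a surjection \<open>\<psi>\<close> of the loop algebra onto
  the simple algebra. Since \<open>[f u, v] = [u, f v]\<close> for a \<open>2\<pi>\<close>-periodic real function \<open>f\<close> and the centre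
  of a simple algebra is trivial, \<open>ker \<psi>\<close> is stable under multiplication by \<open>f\<close>, and \<open>f\<close> acts on the
  quotient through the centroid. By compactness of the circle the functions acting by zero have a common
  zero \<open>p\<close>, and finite dimensionality forces every function vanishing at \<open>p\<close> to act by zero. Hence
  \<open>\<psi> u\<close> depends only on \<open>u p\<close>. As \<open>\<phi> (f u) t = f (p t) \<phi> u t\<close>, the functions \<open>cos \<circ> p\<close> and
  \<open>sin \<circ> p\<close> are smooth, so \<open>p\<close> may be replaced modulo \<open>2\<pi>\<close> by a smooth function.
\<close>

section \<open>Finitely often differentiable functions\<close>

text \<open>Smoothness is graded by order so that closure properties go by induction on
  \<open>n\<close>, and restricted to \<open>S\<close> so that it can be glued from local pieces.
  The derivatives are two-sided ones at the points of \<open>S\<close>, as in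
  \<open>smooth_fun\<close>.\<close>

definition diff_upto :: "nat \<Rightarrow> real set \<Rightarrow> (real \<Rightarrow> 'a::real_normed_vector) \<Rightarrow> bool" where
  "diff_upto n S f \<longleftrightarrow> (\<forall>k<n. \<forall>t\<in>S. (vderiv ^^ k) f differentiable (at t))"

lemma smooth_fun_iff_diff_upto: "smooth_fun f \<longleftrightarrow> (\<forall>n. diff_upto n UNIV f)"
  by (auto simp: smooth_fun_def diff_upto_def)

lemma diff_upto_0 [simp]: "diff_upto 0 S f"
  by (simp add: diff_upto_def)

lemma diff_upto_Suc:
  "diff_upto (Suc n) S f \<longleftrightarrow> (\<forall>t\<in>S. f differentiable (at t)) \<and> diff_upto n S (vderiv f)"
  unfolding diff_upto_def less_Suc_eq_0_disj by (auto simp: funpow_swap1)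

lemma diff_upto_mono: "diff_upto n S f \<Longrightarrow> m \<le> n \<Longrightarrow> T \<subseteq> S \<Longrightarrow> diff_upto m T f"
  by (auto simp: diff_upto_def)

lemma diff_upto_local:
  assumes "\<And>t. t \<in> S \<Longrightarrow> \<exists>T. t \<in> T \<and> diff_upto n T f"
  shows "diff_upto n S f"
  using assms unfolding diff_upto_def by blast

lemma has_vderiv:
  assumes "f differentiable (at t)"
  shows "(f has_vector_derivative vderiv f t) (at t)"
  using assms by (simp add: vderiv_def vector_derivative_works)

lemma vderiv_eqI: "(f has_vector_derivative d) (at t) \<Longrightarrow> vderiv f t = d"
  by (simp add: vderiv_def vector_derivative_at)

text \<open>On an open \<open>S\<close> agreement passes to the derivatives, so the induction can
  replace both functions by their \<open>vderiv\<close>.\<close>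

lemma diff_upto_cong:
  assumes "open S" "\<And>t. t \<in> S \<Longrightarrow> f t = g t" "diff_upto n S f"
  shows "diff_upto n S g"
  using assms(2,3)
proof (induction n arbitrary: f g)
  case (Suc n)
  have D: "(g has_vector_derivative vderiv f t) (at t)" if "t \<in> S" for t
  proof (rule has_vector_derivative_transform_within_open[OF _ assms(1) that])
    show "(f has_vector_derivative vderiv f t) (at t)"
      using Suc.prems(2) that by (intro has_vderiv) (simp add: diff_upto_Suc)
  qed (use Suc.prems(1) in auto)
  have "diff_upto n S (vderiv g)"
  proof (rule Suc.IH)
    show "vderiv f t = vderiv g t" if "t \<in> S" for t
      using vderiv_eqI[OF D[OF that]] by simp
    show "diff_upto n S (vderiv f)"
      using Suc.prems(2) by (simp add: diff_upto_Suc)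
  qed
  then show ?case
    using D by (auto simp: diff_upto_Suc intro: differentiableI_vector)
qed auto

text \<open>Lets an explicit derivative formula, known only on \<open>S\<close>, take the place of
  \<open>vderiv f\<close>; this is the induction step of most closure proofs below.\<close>

lemma diff_upto_SucI:
  assumes "open S" "\<And>t. t \<in> S \<Longrightarrow> (f has_vector_derivative f' t) (at t)" "diff_upto n S f'"
  shows "diff_upto (Suc n) S f"
proof -
  have "diff_upto n S (vderiv f)"
    by (rule diff_upto_cong[OF assms(1) _ assms(3)]) (simp add: vderiv_eqI[OF assms(2)])
  then show ?thesis
    using assms(2) by (auto simp: diff_upto_Suc intro: differentiableI_vector)
qed

section \<open>Closure of the differentiability classes under the usual operations\<close>

lemma diff_upto_const [simp]: "diff_upto n S (\<lambda>_. c)"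
proof (induction n arbitrary: c)
  case (Suc n)
  have "vderiv (\<lambda>_::real. c) = (\<lambda>_. 0)"
    by (auto simp: vderiv_def)
  with Suc show ?case by (simp add: diff_upto_Suc)
qed simp

lemma diff_upto_ident [simp]: "diff_upto n S (\<lambda>t. t)"
proof (cases n)
  case (Suc m)
  have "vderiv (\<lambda>t::real. t) = (\<lambda>_. 1)"
    by (auto simp: vderiv_def intro!: vector_derivative_at)
  with Suc show ?thesis by (simp add: diff_upto_Suc)
qed simp

lemma diff_upto_bounded_linear:
  assumes "bounded_linear T" "open S" "diff_upto n S f"
  shows "diff_upto n S (\<lambda>t. T (f t))"
  using assms(3)
proof (induction n arbitrary: f)
  case (Suc n)
  then show ?case
    by (intro diff_upto_SucI[where f' = "\<lambda>t. T (vderiv f t)"] assms)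
       (auto simp: diff_upto_Suc intro!: bounded_linear.has_vector_derivative[OF assms(1)] has_vderiv)
qed simp

lemma diff_upto_add:
  assumes "open S" "diff_upto n S f" "diff_upto n S g"
  shows "diff_upto n S (\<lambda>t. f t + g t)"
  using assms(2,3)
proof (induction n arbitrary: f g)
  case (Suc n)
  then show ?case
    by (intro diff_upto_SucI[where f' = "\<lambda>t. vderiv f t + vderiv g t"] assms)
       (auto simp: diff_upto_Suc intro!: has_vector_derivative_add has_vderiv)
qed simp

lemma diff_upto_bilinear:
  assumes "bounded_bilinear b" "open S" "diff_upto n S f" "diff_upto n S g"
  shows "diff_upto n S (\<lambda>t. b (f t) (g t))"
  using assms(3,4)
proof (induction n arbitrary: f g)
  case (Suc n)
  have "diff_upto n S f" "diff_upto n S g"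
    using Suc.prems by (auto elim: diff_upto_mono)
  then show ?case
    using Suc by (intro diff_upto_SucI[where f' = "\<lambda>t. b (f t) (vderiv g t) + b (vderiv f t) (g t)"])
      (auto simp: diff_upto_Suc assms(2)
          intro!: diff_upto_add bounded_bilinear.has_vector_derivative[OF assms(1)] has_vderiv)
qed simp

lemmas diff_upto_scaleR = diff_upto_bilinear[OF bounded_bilinear_scaleR]
lemmas diff_upto_inner = diff_upto_bilinear[OF bounded_bilinear_inner]
lemmas diff_upto_mult = diff_upto_bilinear[OF bounded_bilinear_mult]

lemma diff_upto_diff:
  assumes "open S" "diff_upto n S f" "diff_upto n S g"
  shows "diff_upto n S (\<lambda>t. f t - g t)"
  using diff_upto_add[OF assms(1,2) diff_upto_bounded_linear[OF _ assms(1,3), of uminus]]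
  by (simp add: bounded_linear_minus[OF bounded_linear_ident])

lemma diff_upto_power:
  fixes f :: "real \<Rightarrow> real"
  assumes "open S" "diff_upto n S f"
  shows "diff_upto n S (\<lambda>t. f t ^ k)"
  by (induction k) (auto intro!: diff_upto_mult assms)

text \<open>The chain rule keeps the inner function \<open>g\<close> and replaces \<open>f\<close>
  by its derivative, so only \<open>f\<close> is generalised in the induction.\<close>

lemma diff_upto_compose:
  assumes "open S" "open T" "g ` S \<subseteq> T" "diff_upto n T f" "diff_upto n S g"
  shows "diff_upto n S (\<lambda>t. f (g t))"
  using assms(4,5)
proof (induction n arbitrary: f)
  case (Suc n)
  have "((f \<circ> g) has_vector_derivative vderiv g t *\<^sub>R vderiv f (g t)) (at t)" if "t \<in> S" for t
    using that Suc.prems assms(3)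
    by (intro vector_diff_chain_at has_vderiv) (auto simp: diff_upto_Suc)
  then show ?case
    using Suc diff_upto_mono[OF Suc.prems(2), of n S]
    by (intro diff_upto_SucI[where f' = "\<lambda>t. vderiv g t *\<^sub>R vderiv f (g t)"])
       (auto simp: diff_upto_Suc assms o_def intro!: diff_upto_scaleR)
qed simp

text \<open>The derivative is minus the square of the function itself, so the induction hypothesis
  reaches it through the product rule.\<close>

lemma diff_upto_inverse_id:
  fixes S :: "real set"
  assumes "open S" "0 \<notin> S"
  shows "diff_upto n S inverse"
proof (induction n)
  case (Suc n)
  show ?case
  proof (rule diff_upto_SucI[OF assms(1)])
    show "(inverse has_vector_derivative - (inverse t * inverse t)) (at t)" if "t \<in> S" for t :: real
      using that assms(2) DERIV_inverse[of t UNIV]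
      by (auto simp: has_real_derivative_iff_has_vector_derivative[symmetric] power2_eq_square)
    show "diff_upto n S (\<lambda>t. - (inverse t * inverse t))"
      using diff_upto_diff[OF assms(1) diff_upto_const[of _ _ 0] diff_upto_mult[OF assms(1) Suc Suc]]
      by simp
  qed
qed simp

lemma diff_upto_inverse:
  fixes f :: "real \<Rightarrow> real"
  assumes "open S" "diff_upto n S f" "\<And>t. t \<in> S \<Longrightarrow> f t \<noteq> 0"
  shows "diff_upto n S (\<lambda>t. inverse (f t))"
  by (rule diff_upto_compose[where T = "- {0}", OF assms(1)])
     (use assms in \<open>auto intro!: diff_upto_inverse_id\<close>)

text \<open>Proved jointly, since each function is up to sign the derivative of the other.\<close>

lemma diff_upto_sin_cos: "diff_upto n UNIV (sin :: real \<Rightarrow> real) \<and> diff_upto n UNIV (cos :: real \<Rightarrow> real)"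
proof (induction n)
  case (Suc n)
  have "diff_upto (Suc n) UNIV (sin :: real \<Rightarrow> real)"
    using Suc by (intro diff_upto_SucI[where f' = cos])
      (auto simp: has_real_derivative_iff_has_vector_derivative[symmetric] intro!: derivative_eq_intros)
  moreover have "diff_upto n UNIV (\<lambda>t. - sin t :: real)"
    using diff_upto_diff[of UNIV n "\<lambda>_. 0" "sin :: real \<Rightarrow> real"] Suc by simp
  then have "diff_upto (Suc n) UNIV (cos :: real \<Rightarrow> real)"
    by (intro diff_upto_SucI[where f' = "\<lambda>t. - sin t"])
      (auto simp: has_real_derivative_iff_has_vector_derivative[symmetric] intro!: derivative_eq_intros)
  ultimately show ?case by blast
qed simp

text \<open>The span of this family is closed under derivation, which makes each member smooth.\<close>

definition flat :: "nat \<Rightarrow> real \<Rightarrow> real" where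
  "flat k x = (if x \<le> 0 then 0 else exp (- inverse x) * inverse x ^ k)"

text \<open>From the right, substituting \<open>y = inverse x\<close> turns the claim into the decay
  of \<open>y ^ k / exp y\<close> at infinity; from the left the function is constantly
  zero.\<close>

lemma flat_tendsto_0: "(flat k \<longlongrightarrow> 0) (at 0)"
proof -
  have "((\<lambda>x::real. inverse x ^ k / exp (inverse x)) \<longlongrightarrow> 0) (at_right 0)"
    by (rule filterlim_compose[OF tendsto_power_div_exp_0 filterlim_inverse_at_top_right])
  then have "(flat k \<longlongrightarrow> 0) (at_right 0)"
    by (rule Lim_transform_eventually)
       (auto simp: flat_def eventually_at_right_less exp_minus field_simps
         intro: eventually_mono[OF eventually_at_right_less])
  moreover have "(flat k \<longlongrightarrow> 0) (at_left 0)"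
    by (rule Lim_transform_eventually[OF tendsto_const])
       (auto simp: flat_def intro!: eventually_at_leftI[of "-1"])
  ultimately show ?thesis by (rule filterlim_split_at_real[rotated])
qed

lemma flat_has_derivative:
  "(flat k has_real_derivative flat (k + 2) x - real k * flat (k + 1) x) (at x)"
proof -
  consider "x < 0" | "x = 0" | "x > 0" by linarith
  then show ?thesis
  proof cases
    case 1
    have "((\<lambda>_. 0) has_real_derivative 0) (at x)" by simp
    then have "(flat k has_real_derivative 0) (at x)"
      by (rule has_field_derivative_transform_within_open[where S = "{..<0}"])
         (use 1 in \<open>auto simp: flat_def\<close>)
    with 1 show ?thesis by (simp add: flat_def)
  next
    case 2
    \<comment> \<open>The difference quotient of \<open>flat k\<close> at 0 is
      \<open>flat (k + 1)\<close>, whose limit is already known.\<close>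
    have "((\<lambda>h. (flat k (0 + h) - flat k 0) / h) \<longlongrightarrow> 0) (at 0)"
      using flat_tendsto_0[of "k + 1"]
      by (rule Lim_transform_eventually) (auto simp: flat_def field_simps intro!: always_eventually)
    with 2 show ?thesis by (simp add: DERIV_def flat_def)
  next
    case 3
    have "((\<lambda>x. exp (- inverse x) * inverse x ^ k) has_real_derivative
        flat (k + 2) x - real k * flat (k + 1) x) (at x)"
    proof -
      \<comment> \<open>For \<open>k = 0\<close> the exponent \<open>k - 1\<close> is truncated, and
        the factor \<open>k\<close> makes both sides zero.\<close>
      have "k * inverse x ^ (k - 1) * (inverse x * inverse x) = k * inverse x ^ (k + 1)"
        by (cases k) auto
      then show ?thesis
        using 3 by (auto intro!: derivative_eq_intros simp: flat_def algebra_simps)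
    qed
    then show ?thesis
      by (rule has_field_derivative_transform_within_open[where S = "{0<..}"])
         (use 3 in \<open>auto simp: flat_def\<close>)
  qed
qed

lemma diff_upto_flat: "diff_upto n UNIV (flat k)"
proof (induction n arbitrary: k)
  case (Suc n)
  show ?case
    by (rule diff_upto_SucI[where f' = "\<lambda>x. flat (k + 2) x - real k * flat (k + 1) x"])
       (use flat_has_derivative in \<open>auto simp: has_real_derivative_iff_has_vector_derivative[symmetric] Suc
          intro!: diff_upto_diff diff_upto_mult\<close>)
qed simp

text \<open>A smooth function that is positive exactly on the open interval from -2 to 2. The radius
  2 is below \<open>pi\<close>, so translates by multiples of the period have supports separated by
  gaps; it is above 1, which leaves a window on which the function can be inverted.\<close>

definition bump :: "real \<Rightarrow> real" where
  "bump x = flat 0 (4 - x\<^sup>2)"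

lemma bump_pos: "\<bar>x\<bar> < 2 \<Longrightarrow> bump x > 0"
  using abs_square_less_1[of "x / 2"] by (simp add: bump_def flat_def power_divide)

lemma bump_eq_0: "\<bar>x\<bar> \<ge> 2 \<Longrightarrow> bump x = 0"
  using abs_le_square_iff[of 2 x] by (simp add: bump_def flat_def)

lemma diff_upto_bump_shift: "diff_upto n UNIV (\<lambda>t. bump (t - a))"
proof -
  have "diff_upto n UNIV (\<lambda>t. 4 - (t - a)\<^sup>2)"
    by (intro diff_upto_diff diff_upto_power) auto
  then show ?thesis
    unfolding bump_def by (intro diff_upto_compose[OF _ _ _ diff_upto_flat]) auto
qed

text \<open>The angle is obtained by integrating the angular velocity of the curve
  \<open>(c, s)\<close> on the unit circle, starting from any angle at time 0. The inner product of
  the curve with \<open>(cos \<theta>, sin \<theta>)\<close> is then constantly 1.\<close>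

lemma smooth_angle_lift:
  fixes c s :: "real \<Rightarrow> real"
  assumes c: "smooth_fun c" and s: "smooth_fun s" and unit: "\<And>t. (c t)\<^sup>2 + (s t)\<^sup>2 = 1"
  obtains \<theta> where "smooth_fun \<theta>" "\<And>t. cos (\<theta> t) = c t" "\<And>t. sin (\<theta> t) = s t"
proof -
  have cs: "diff_upto n UNIV c" "diff_upto n UNIV s" for n
    using c s by (auto simp: smooth_fun_iff_diff_upto)
  have cs': "diff_upto n UNIV (vderiv c)" "diff_upto n UNIV (vderiv s)" for n
    using cs[of "Suc n"] by (auto simp: diff_upto_Suc)
  \<comment> \<open>The angular velocity of a curve on the unit circle.\<close>
  define w where "w = (\<lambda>t. c t * vderiv s t - s t * vderiv c t)"
  have w: "diff_upto n UNIV w" for n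
    unfolding w_def by (intro diff_upto_diff diff_upto_mult cs cs') auto
  have "isCont w t" for t
    using w[of 1] by (auto simp: diff_upto_def differentiable_imp_continuous_within)
  then obtain F where F: "\<And>t. (F has_vector_derivative w t) (at t)"
    using einterval_antiderivative[of "-\<infinity>" "\<infinity>" w] by auto
  have "c 0 ^ 2 + s 0 ^ 2 = 1" by (rule unit)
  then obtain a where a: "c 0 = cos a" "s 0 = sin a"
    using sincos_total_2pi by metis
  define \<theta> where "\<theta> t = F t - F 0 + a" for t
  have th: "(\<theta> has_real_derivative w t) (at t)" for t
    unfolding \<theta>_def using F[of t]
    by (auto simp: has_real_derivative_iff_has_vector_derivative[symmetric] intro!: derivative_eq_intros)
  have dc: "(c has_real_derivative vderiv c t) (at t)" and ds: "(s has_real_derivative vderiv s t) (at t)" for t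
    using cs[of 1] by (auto simp: has_real_derivative_iff_has_vector_derivative diff_upto_def intro!: has_vderiv)
  have orth: "c t * vderiv c t + s t * vderiv s t = 0" for t
  proof -
    have "((\<lambda>t. (c t)\<^sup>2 + (s t)\<^sup>2) has_real_derivative 2 * (c t * vderiv c t + s t * vderiv s t)) (at t)"
      by (auto intro!: derivative_eq_intros dc ds)
    moreover have "((\<lambda>t. (c t)\<^sup>2 + (s t)\<^sup>2) has_real_derivative 0) (at t)"
      by (simp add: unit)
    ultimately show ?thesis using DERIV_unique by fastforce
  qed
  \<comment> \<open>Orthogonality of position and velocity, the definition of \<open>w\<close> and
    the unit length determine the velocity: it is \<open>w\<close> times the position rotated by a
    right angle.\<close>
  have c': "vderiv c t = - s t * w t" and s': "vderiv s t = c t * w t" for t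
    using orth[of t] unit[of t] unfolding w_def by algebra+
  let ?p = "\<lambda>t. c t * cos (\<theta> t) + s t * sin (\<theta> t)"
  have "(?p has_real_derivative 0) (at t)" for t
    by (rule derivative_eq_intros dc ds th refl)+ (simp add: c' s' algebra_simps)
  then have "?p t = ?p 0" for t
    using DERIV_isconst_all by blast
  moreover have "?p 0 = 1"
    using unit[of 0] by (simp add: a \<theta>_def power2_eq_square)
  ultimately have p: "?p t = 1" for t by simp
  \<comment> \<open>Two unit vectors with inner product 1 coincide: the left side expands to
    \<open>2 - 2 * ?p t\<close>.\<close>
  have "(cos (\<theta> t) - c t)\<^sup>2 + (sin (\<theta> t) - s t)\<^sup>2 = 0" for t
    using p[of t] unit[of t] sin_cos_squared_add[of "\<theta> t"] by algebra
  then have eq: "cos (\<theta> t) = c t" "sin (\<theta> t) = s t" for t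
    by (auto simp: sum_power2_eq_zero_iff)
  have "diff_upto n UNIV \<theta>" for n
    using diff_upto_SucI[OF open_UNIV _ w[of n], of \<theta>] th diff_upto_mono[of "Suc n" UNIV \<theta> n UNIV]
    by (auto simp: has_real_derivative_iff_has_vector_derivative)
  then show ?thesis
    using that[of \<theta>] eq by (auto simp: smooth_fun_iff_diff_upto)
qed

section \<open>Twisted loops\<close>

text \<open>Integer iterates of a bijection, needed because a loop is moved by the n-th iterate of
  its twist when time is shifted by n periods in either direction.\<close>

definition int_funpow :: "('a \<Rightarrow> 'a) \<Rightarrow> int \<Rightarrow> 'a \<Rightarrow> 'a" where
  "int_funpow f n = (if n \<ge> 0 then f ^^ nat n else inv f ^^ nat (- n))"

lemma int_funpow_0 [simp]: "int_funpow f 0 x = x"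
  by (simp add: int_funpow_def)

lemma int_funpow_add_one:
  assumes "bij f"
  shows "int_funpow f (n + 1) x = f (int_funpow f n x)"
proof -
  show ?thesis
  proof (cases n)
    case (nonneg m)
    then show ?thesis by (simp add: int_funpow_def nat_add_distrib)
  next
    case (neg m)
    then have "nat (- n) = Suc m" "nat (- (n + 1)) = m" by auto
    moreover have "f (inv f y) = y" for y
      using assms by (simp add: bij_is_surj surj_f_inv_f)
    \<comment> \<open>For \<open>m = 0\<close> the exponent \<open>n + 1\<close> is 0 and falls into
      the nonnegative branch of the definition, hence the case split on \<open>m\<close>.\<close>
    ultimately show ?thesis
      using neg by (cases m) (auto simp: int_funpow_def)
  qed
qed

lemma bounded_linear_funpow:
  "bounded_linear (f :: 'a::real_normed_vector \<Rightarrow> 'a) \<Longrightarrow> bounded_linear (f ^^ n)"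
  by (induction n) (auto simp: id_def o_def intro: bounded_linear_compose bounded_linear_ident)

text \<open>An injective linear map has a linear left inverse, which for a bijection is
  \<open>inv f\<close>; boundedness is automatic in finite dimension.\<close>

lemma bounded_linear_int_funpow:
  fixes f :: "'a::euclidean_space \<Rightarrow> 'a"
  assumes "linear f" "bij f"
  shows "bounded_linear (int_funpow f n)"
proof -
  obtain g where "linear g" "g \<circ> f = id"
    using linear_injective_left_inverse[of f] assms by (auto simp: bij_def)
  then have "inv f = g"
    using assms(2) by (metis bij_is_surj comp_id fun.map_comp o_assoc id_comp surj_iff)
  then have "linear (inv f)" using \<open>linear g\<close> by simp
  then show ?thesis
    using assms by (auto simp: int_funpow_def linear_conv_bounded_linear intro: bounded_linear_funpow)
qed

section \<open>Translation by periods and extension from one period\<close>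

lemma loop_alg_iff:
  "u \<in> loop_alg \<sigma> \<longleftrightarrow> (\<forall>n. diff_upto n UNIV u) \<and> (\<forall>t. u (t + 2 * pi) = \<sigma> (u t))"
  by (simp add: loop_alg_def smooth_fun_iff_diff_upto)

text \<open>Induction in both directions from 0; in the downward step \<sigma> is applied to both
  sides and cancelled by injectivity.\<close>

lemma loop_alg_shift:
  assumes "bij \<sigma>" "u \<in> loop_alg \<sigma>"
  shows "u (t + 2 * pi * of_int n) = int_funpow \<sigma> n (u t)"
proof (induction n rule: int_induct[where k = 0])
  case base
  then show ?case by simp
next
  case (step1 n)
  have "u (t + 2 * pi * of_int (n + 1)) = u (t + 2 * pi * of_int n + 2 * pi)"
    by (simp add: algebra_simps)
  also have "\<dots> = \<sigma> (u (t + 2 * pi * of_int n))"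
    using assms(2) by (simp add: loop_alg_iff)
  finally have "u (t + 2 * pi * of_int (n + 1)) = \<sigma> (u (t + 2 * pi * of_int n))" .
  then show ?case
    using step1 assms(1) by (simp add: int_funpow_add_one)
next
  case (step2 n)
  have "\<sigma> (u (t + 2 * pi * of_int (n - 1))) = u (t + 2 * pi * of_int (n - 1) + 2 * pi)"
    using assms(2) by (simp add: loop_alg_iff)
  also have "\<dots> = u (t + 2 * pi * of_int n)"
    by (simp add: algebra_simps)
  also have "\<dots> = \<sigma> (int_funpow \<sigma> (n - 1) (u t))"
    using step2 int_funpow_add_one[OF assms(1), of "n - 1"] by simp
  finally show ?case
    using assms(1) by (simp add: bij_def inj_eq)
qed

text \<open>The index of the translate of the half-open period centred at \<open>a\<close> that
  contains \<open>t\<close>.\<close>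

definition winding :: "real \<Rightarrow> real \<Rightarrow> int" where
  "winding a t = \<lfloor>(t - a + pi) / (2 * pi)\<rfloor>"

lemma winding_eq_iff:
  "winding a t = k \<longleftrightarrow> t - 2 * pi * of_int k \<in> {a - pi..<a + pi}"
  by (auto simp: winding_def floor_eq_iff field_simps)

lemma loop_alg_eqI:
  assumes "bij \<sigma>" "u \<in> loop_alg \<sigma>" "v \<in> loop_alg \<sigma>"
    and eq: "\<And>t. t \<in> {a - pi..<a + pi} \<Longrightarrow> u t = v t"
  shows "u = v"
proof
  fix t
  define k where "k = winding a t"
  define s where "s = t - 2 * pi * of_int k"
  have "s \<in> {a - pi..<a + pi}"
    unfolding s_def using winding_eq_iff[of a t k] by (simp add: k_def)
  then show "u t = v t"
    using loop_alg_shift[OF assms(1,2), of s k] loop_alg_shift[OF assms(1,3), of s k] eq[of s]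
    by (simp add: s_def)
qed

text \<open>The copy of \<open>h\<close> on the k-th translate of the period is moved by the k-th
  iterate of \<sigma>. Smoothness is clear inside each translate, and at the seams the extension is
  locally zero because the support has radius \<open>2 < pi\<close>.\<close>

lemma twisted_extension:
  fixes h :: "real \<Rightarrow> 'a::euclidean_space"
  assumes "linear \<sigma>" "bij \<sigma>" and h: "\<And>n. diff_upto n UNIV h"
    and supp: "\<And>t. \<bar>t - a\<bar> \<ge> 2 \<Longrightarrow> h t = 0"
  obtains w where "w \<in> loop_alg \<sigma>" "\<And>t. t \<in> {a - pi..<a + pi} \<Longrightarrow> w t = h t"
proof -
  note bl = bounded_linear_int_funpow[OF assms(1,2)]
  define w where "w t = int_funpow \<sigma> (winding a t) (h (t - 2 * pi * of_int (winding a t)))" for t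
  have w_eq: "w t = int_funpow \<sigma> k (h (t - 2 * pi * of_int k))"
    if "t - 2 * pi * of_int k \<in> {a - pi..<a + pi}" for t k
    using that unfolding winding_eq_iff[symmetric] by (simp add: w_def)
  \<comment> \<open>The open gap between the supports of the copies with indices
    \<open>k - 1\<close> and \<open>k\<close>.\<close>
  have w_eq_0: "w t = 0" if "a + 2 * pi * of_int k - 2 * pi + 2 < t" "t < a + 2 * pi * of_int k - 2" for t k
  proof -
    have "\<bar>t - 2 * pi * of_int m - a\<bar> \<ge> 2" for m
    proof (cases "m < k")
      case True
      then have "pi * of_int (m + 1) \<le> pi * of_int k"
        by (intro mult_left_mono) (auto simp del: of_int_add)
      with that(1) show ?thesis by (simp add: algebra_simps)
    next
      case False
      then have "pi * of_int k \<le> pi * of_int m"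
        by (intro mult_left_mono) auto
      with that(2) show ?thesis by linarith
    qed
    then show ?thesis
      by (simp add: w_def supp linear_0[OF bounded_linear.linear[OF bl]])
  qed
  have "diff_upto n UNIV w" for n
  proof (rule diff_upto_local)
    fix t :: real
    define k where "k = winding a t"
    have t: "a - pi \<le> t - 2 * pi * of_int k" "t - 2 * pi * of_int k < a + pi"
      using winding_eq_iff[of a t k] by (auto simp: k_def)
    show "\<exists>T. t \<in> T \<and> diff_upto n T w"
    proof (cases "t = a + 2 * pi * of_int k - pi")
      \<comment> \<open>The left endpoint of a translate is the only seam to treat, since the
        periods are half-open; it lies in the gap just described.\<close>
      case True
      let ?T = "{a + 2 * pi * of_int k - 2 * pi + 2 <..< a + 2 * pi * of_int k - 2}"
      have "diff_upto n ?T w"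
        by (rule diff_upto_cong[OF _ _ diff_upto_const[of _ _ 0]]) (auto simp: w_eq_0)
      moreover have "t \<in> ?T"
        using True pi_gt3 by auto
      ultimately show ?thesis by blast
    next
      case False
      let ?T = "{a + 2 * pi * of_int k - pi <..< a + 2 * pi * of_int k + pi}"
      have "diff_upto n ?T (\<lambda>t. h (t - 2 * pi * of_int k))"
        by (rule diff_upto_compose[OF _ open_UNIV _ h]) (auto intro!: diff_upto_diff)
      then have "diff_upto n ?T (\<lambda>t. int_funpow \<sigma> k (h (t - 2 * pi * of_int k)))"
        by (intro diff_upto_bounded_linear[OF bl]) auto
      then have "diff_upto n ?T w"
        by (rule diff_upto_cong[rotated 2]) (auto intro!: w_eq[symmetric])
      moreover have "t \<in> ?T"
        using False t by auto
      ultimately show ?thesis by blast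
    qed
  qed
  moreover have "w (t + 2 * pi) = \<sigma> (w t)" for t
  proof -
    have "winding a (t + 2 * pi) = winding a t + 1"
      unfolding winding_eq_iff using winding_eq_iff[of a t "winding a t"] by (auto simp: algebra_simps)
    then show ?thesis
      by (simp add: w_def int_funpow_add_one[OF assms(2)] distrib_left)
  qed
  ultimately have "w \<in> loop_alg \<sigma>"
    by (simp add: loop_alg_iff)
  moreover have "w t = h t" if "t \<in> {a - pi..<a + pi}" for t
    using w_eq[of t 0] that by simp
  ultimately show ?thesis using that by blast
qed

text \<open>Provides a loop with a prescribed value at a prescribed time, up to the positive factor
  \<open>bump 0\<close>.\<close>

lemma loop_alg_bump:
  fixes x :: "'a::euclidean_space"
  assumes "linear \<sigma>" "bij \<sigma>"
  obtains w where "w \<in> loop_alg \<sigma>" "\<And>t. t \<in> {a - pi..<a + pi} \<Longrightarrow> w t = bump (t - a) *\<^sub>R x"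
  by (rule twisted_extension[OF assms, of "\<lambda>t. bump (t - a) *\<^sub>R x" a])
     (auto simp: bump_eq_0 intro!: diff_upto_scaleR diff_upto_bump_shift that)

section \<open>The ring of smooth periodic functions and its action on loops\<close>

abbreviation periodic :: "(real \<Rightarrow> real) set" where
  "periodic \<equiv> loop_alg (\<lambda>x. x)"

lemma loop_alg_add:
  assumes "linear \<sigma>" "u \<in> loop_alg \<sigma>" "v \<in> loop_alg \<sigma>"
  shows "(\<lambda>t. u t + v t) \<in> loop_alg \<sigma>"
  using assms by (auto simp: loop_alg_iff linear_add intro: diff_upto_add)

lemma loop_alg_bounded_linear:
  assumes "bounded_linear T" "\<And>x. T (\<sigma> x) = \<sigma>' (T x)" "u \<in> loop_alg \<sigma>"
  shows "(\<lambda>t. T (u t)) \<in> loop_alg \<sigma>'"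
  using assms by (auto simp: loop_alg_iff intro: diff_upto_bounded_linear)

lemma loop_alg_bilinear:
  assumes "bounded_bilinear b" "\<And>x y. b (\<sigma> x) (\<tau> y) = \<upsilon> (b x y)" "u \<in> loop_alg \<sigma>" "v \<in> loop_alg \<tau>"
  shows "(\<lambda>t. b (u t) (v t)) \<in> loop_alg \<upsilon>"
  using assms by (auto simp: loop_alg_iff intro: diff_upto_bilinear)

lemma loop_alg_scaleR:
  assumes "linear \<sigma>" "f \<in> periodic" "u \<in> loop_alg \<sigma>"
  shows "(\<lambda>t. f t *\<^sub>R u t) \<in> loop_alg \<sigma>"
  using assms by (intro loop_alg_bilinear[OF bounded_bilinear_scaleR]) (auto simp: linear_scale)

lemma loop_alg_sum:
  assumes "linear \<sigma>" "\<And>i. i \<in> I \<Longrightarrow> u i \<in> loop_alg \<sigma>"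
  shows "(\<lambda>t. \<Sum>i\<in>I. u i t) \<in> loop_alg \<sigma>"
  using assms(2)
proof (induction I rule: infinite_finite_induct)
  case (insert i I)
  then show ?case by (simp add: loop_alg_add[OF assms(1)])
qed (auto simp: loop_alg_iff linear_0[OF assms(1)])

lemma periodic_const: "(\<lambda>_. c) \<in> periodic"
  by (simp add: loop_alg_iff)

lemma periodic_add: "f \<in> periodic \<Longrightarrow> g \<in> periodic \<Longrightarrow> (\<lambda>t. f t + g t) \<in> periodic"
  by (rule loop_alg_add[OF linear_id[unfolded id_def]])

lemma periodic_mult: "f \<in> periodic \<Longrightarrow> g \<in> periodic \<Longrightarrow> (\<lambda>t. f t * g t) \<in> periodic"
  by (auto simp: loop_alg_iff intro: diff_upto_mult)

lemma periodic_power: "f \<in> periodic \<Longrightarrow> (\<lambda>t. f t ^ k) \<in> periodic"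
  by (induction k) (auto simp: periodic_const periodic_mult)

lemma periodic_inverse: "f \<in> periodic \<Longrightarrow> (\<And>t. f t \<noteq> 0) \<Longrightarrow> (\<lambda>t. inverse (f t)) \<in> periodic"
  by (auto simp: loop_alg_iff intro: diff_upto_inverse)

lemma periodic_sum: "(\<And>i. i \<in> I \<Longrightarrow> f i \<in> periodic) \<Longrightarrow> (\<lambda>t. \<Sum>i\<in>I. f i t) \<in> periodic"
  by (rule loop_alg_sum[OF linear_id[unfolded id_def]])

text \<open>Formulated for a sequence rather than a set, so that a repeated vector also counts as a
  relation. If the first \<open>DIM('b) + 1\<close> vectors are distinct there are too many of them
  to be independent; otherwise two equal ones are subtracted.\<close>

lemma exists_linear_relation:
  fixes v :: "nat \<Rightarrow> 'b::euclidean_space"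
  obtains a d where "\<exists>k\<le>d. a k \<noteq> 0" "(\<Sum>k\<le>d. a k *\<^sub>R v k) = 0"
proof (cases "inj_on v {..DIM('b)}")
  case True
  then have "dependent (v ` {..DIM('b)})"
    by (intro dependent_biggerset) (simp add: card_image)
  then obtain b where b: "\<exists>x\<in>v ` {..DIM('b)}. b x \<noteq> 0" "(\<Sum>x\<in>v ` {..DIM('b)}. b x *\<^sub>R x) = 0"
    by (auto simp: dependent_finite)
  then show ?thesis
    using that[of "DIM('b)" "b \<circ> v"] True by (auto simp: sum.reindex)
next
  case False
  then obtain i j where ij: "i \<noteq> j" "v i = v j"
    by (auto simp: inj_on_def)
  define a where "a k = (if k = i then 1 else if k = j then -1 else 0 :: real)" for k
  have "(\<Sum>k\<le>max i j. a k *\<^sub>R v k) = (\<Sum>k\<in>{i, j}. a k *\<^sub>R v k)"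
    by (rule sum.mono_neutral_right) (auto simp: a_def)
  also have "\<dots> = 0"
    using ij by (simp add: a_def)
  finally show ?thesis
    by (rule that[rotated]) (auto simp: a_def intro!: exI[of _ i])
qed

section \<open>Simple quotients of loop algebras\<close>

text \<open>The map \<rho> embeds the reals into the scalar field, which treats real and complex
  scalars at once: all analysis is done over the reals, where finite dimension turns linearity into
  boundedness.\<close>

lemma lie_real_structure:
  fixes sc :: "'k::field \<Rightarrow> 'a::euclidean_space \<Rightarrow> 'a"
  assumes "lie_algebra sc br" "\<And>r x. sc (\<rho> r) x = r *\<^sub>R x"
  shows lie_bounded_bilinear: "bounded_bilinear br"
    and lie_bounded_linear_scale: "bounded_linear (sc c)"
    and lie_scale_scaleR: "sc c (r *\<^sub>R x) = r *\<^sub>R sc c x"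
proof -
  have vs: "vector_space sc" and
    br: "br (x + y) z = br x z + br y z" "br x (y + z) = br x y + br x z"
       "br (sc c x) y = sc c (br x y)" "br x (sc c y) = sc c (br x y)" for x y z c
    using assms(1) unfolding lie_algebra_def by blast+
  show *: "sc c (r *\<^sub>R x) = r *\<^sub>R sc c x" for c r x
    unfolding assms(2)[symmetric] vector_space.vector_space_assms(3)[OF vs] by (simp add: mult.commute)
  show "bounded_linear (sc c)"
    unfolding linear_conv_bounded_linear[symmetric]
    by (rule linearI) (simp_all add: * vector_space.vector_space_assms(1)[OF vs])
  have "bilinear br"
    unfolding bilinear_def linear_iff using br by (simp flip: assms(2))
  then show "bounded_bilinear br"
    by (simp add: bilinear_conv_bounded_bilinear)
qed

lemma lie_hom_linear:
  assumes "lie_hom sc1 br1 sc2 br2 f"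
    "\<And>r x. sc1 (\<rho> r) x = r *\<^sub>R x" "\<And>r y. sc2 (\<rho> r) y = r *\<^sub>R y"
  shows "linear f"
  using assms(1) unfolding lie_hom_def Vector_Spaces.linear_iff linear_iff
  by (metis assms(2,3))

text \<open>An abstract homomorphism from the loop algebra onto a simple Lie algebra, later \<phi>
  followed by evaluation at a fixed time. Nothing is known about \<psi> outside the loop algebra,
  hence the membership premises throughout.\<close>

locale loop_quotient =
  fixes sc1 :: "'k::field \<Rightarrow> 'a::euclidean_space \<Rightarrow> 'a" and br1 :: "'a \<Rightarrow> 'a \<Rightarrow> 'a" and \<sigma> :: "'a \<Rightarrow> 'a"
    and sc2 :: "'k \<Rightarrow> 'b::euclidean_space \<Rightarrow> 'b" and br2 :: "'b \<Rightarrow> 'b \<Rightarrow> 'b"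
    and \<rho> :: "real \<Rightarrow> 'k" and \<psi> :: "(real \<Rightarrow> 'a) \<Rightarrow> 'b"
  assumes real1: "sc1 (\<rho> r) x = r *\<^sub>R x" and real2: "sc2 (\<rho> r) y = r *\<^sub>R y"
    and lie1: "lie_algebra sc1 br1" and lie2: "lie_algebra sc2 br2" and simple: "simple_lie sc2 br2"
    and aut: "lie_aut sc1 br1 \<sigma>"
    and \<psi>_add: "u \<in> loop_alg \<sigma> \<Longrightarrow> v \<in> loop_alg \<sigma> \<Longrightarrow> \<psi> (\<lambda>t. u t + v t) = \<psi> u + \<psi> v"
    and \<psi>_scale: "u \<in> loop_alg \<sigma> \<Longrightarrow> \<psi> (\<lambda>t. sc1 c (u t)) = sc2 c (\<psi> u)"
    and \<psi>_bracket: "u \<in> loop_alg \<sigma> \<Longrightarrow> v \<in> loop_alg \<sigma> \<Longrightarrow> \<psi> (\<lambda>t. br1 (u t) (v t)) = br2 (\<psi> u) (\<psi> v)"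
    and \<psi>_surj: "\<exists>u\<in>loop_alg \<sigma>. \<psi> u = y"
begin

section \<open>Arithmetic of loops and of the quotient map\<close>

abbreviation "L \<equiv> loop_alg \<sigma>"

lemma linear_\<sigma>: "linear \<sigma>"
  using lie_hom_linear real1 aut unfolding lie_aut_def by blast

lemma bij_\<sigma>: "bij \<sigma>"
  using aut by (simp add: lie_aut_def)

lemmas L_add = loop_alg_add[OF linear_\<sigma>]
lemmas L_scaleR = loop_alg_scaleR[OF linear_\<sigma>]
lemmas br1_bilinear = lie_bounded_bilinear[OF lie1 real1]
lemmas br2_bilinear = lie_bounded_bilinear[OF lie2 real2]

lemma L_bracket: "u \<in> L \<Longrightarrow> v \<in> L \<Longrightarrow> (\<lambda>t. br1 (u t) (v t)) \<in> L"
  using aut by (intro loop_alg_bilinear[OF br1_bilinear]) (auto simp: lie_aut_def lie_hom_def)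

lemma L_scale: "u \<in> L \<Longrightarrow> (\<lambda>t. sc1 c (u t)) \<in> L"
  using aut by (intro loop_alg_bounded_linear[OF lie_bounded_linear_scale[OF lie1 real1]])
    (auto simp: lie_aut_def lie_hom_def Vector_Spaces.linear_iff)

lemma L_const_scaleR: "u \<in> L \<Longrightarrow> (\<lambda>t. r *\<^sub>R u t) \<in> L"
  by (rule L_scaleR[OF periodic_const])

lemma \<psi>_scaleR: "u \<in> L \<Longrightarrow> \<psi> (\<lambda>t. r *\<^sub>R u t) = r *\<^sub>R \<psi> u"
  using \<psi>_scale[of u "\<rho> r"] by (simp add: real1 real2)

lemma \<psi>_zero: "\<psi> (\<lambda>_. 0) = 0"
proof -
  obtain u where "u \<in> L" using \<psi>_surj by blast
  then show ?thesis using \<psi>_scaleR[of u 0] by simp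
qed

lemma L_diff: "u \<in> L \<Longrightarrow> v \<in> L \<Longrightarrow> (\<lambda>t. u t - v t) \<in> L"
  using L_add[OF _ L_const_scaleR[of v "-1"], of u] by simp

lemma \<psi>_diff: "u \<in> L \<Longrightarrow> v \<in> L \<Longrightarrow> \<psi> (\<lambda>t. u t - v t) = \<psi> u - \<psi> v"
  using \<psi>_add[OF _ L_const_scaleR[of v "-1"], of u] \<psi>_scaleR[of v "-1"] by simp

lemma \<psi>_sum:
  assumes "\<And>i. i \<in> I \<Longrightarrow> u i \<in> L"
  shows "\<psi> (\<lambda>t. \<Sum>i\<in>I. u i t) = (\<Sum>i\<in>I. \<psi> (u i))"
  using assms
proof (induction I rule: infinite_finite_induct)
  case (insert i I)
  then show ?case
    by (simp add: \<psi>_add loop_alg_sum[OF linear_\<sigma>])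
qed (auto simp: \<psi>_zero)

lemma subspaceI2:
  assumes "0 \<in> I" "\<And>x y. x \<in> I \<Longrightarrow> y \<in> I \<Longrightarrow> x + y \<in> I" "\<And>c x. x \<in> I \<Longrightarrow> sc2 c x \<in> I"
  shows "module.subspace sc2 I"
proof -
  interpret vector_space sc2 using lie2 by (simp add: lie_algebra_def)
  show ?thesis using assms by (auto simp: subspace_def)
qed

text \<open>The centre is an ideal, and it is not everything because a simple algebra has a nonzero
  bracket.\<close>

lemma center_trivial:
  assumes "\<And>y. br2 y x = 0"
  shows "x = 0"
proof -
  let ?Z = "{x. \<forall>y. br2 y x = 0}"
  have "module.subspace sc2 ?Z"
    using lie2 bounded_bilinear.zero_right[OF br2_bilinear]
      linear_0[OF bounded_linear.linear[OF lie_bounded_linear_scale[OF lie2 real2]]]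
    by (intro subspaceI2) (auto simp: lie_algebra_def)
  then have "lie_ideal sc2 br2 ?Z"
    using bounded_bilinear.zero_right[OF br2_bilinear] by (simp add: lie_ideal_def)
  then have "?Z = {0} \<or> ?Z = UNIV"
    using simple by (simp add: simple_lie_def)
  moreover have "?Z \<noteq> UNIV"
    using simple by (auto simp: simple_lie_def)
  ultimately show ?thesis using assms by blast
qed

text \<open>In a bracket with a loop \<open>v\<close> over an arbitrary \<open>y\<close>, the factor
  \<open>f\<close> can be moved to \<open>v\<close>, leaving \<open>u\<close> with image 0; so the
  image of the product is central.\<close>

lemma kernel_periodic_submodule:
  assumes f: "f \<in> periodic" and u: "u \<in> L" "\<psi> u = 0"
  shows "\<psi> (\<lambda>t. f t *\<^sub>R u t) = 0"
proof (rule center_trivial)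
  fix y
  obtain v where v: "v \<in> L" "\<psi> v = y" using \<psi>_surj by blast
  have "br2 y (\<psi> (\<lambda>t. f t *\<^sub>R u t)) = \<psi> (\<lambda>t. br1 (v t) (f t *\<^sub>R u t))"
    using f u v by (simp add: \<psi>_bracket L_scaleR)
  also have "\<dots> = \<psi> (\<lambda>t. br1 (f t *\<^sub>R v t) (u t))"
    by (simp add: bounded_bilinear.scaleR_left[OF br1_bilinear] bounded_bilinear.scaleR_right[OF br1_bilinear])
  also have "\<dots> = 0"
    using f u v by (simp add: \<psi>_bracket L_scaleR bounded_bilinear.zero_right[OF br2_bilinear])
  finally show "br2 y (\<psi> (\<lambda>t. f t *\<^sub>R u t)) = 0" .
qed

text \<open>The ideal of periodic functions that act by zero on the quotient of the loop algebra by
  the kernel of \<psi>.\<close>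

definition annihilator :: "(real \<Rightarrow> real) set" where
  "annihilator = {f \<in> periodic. \<forall>u\<in>L. \<psi> (\<lambda>t. f t *\<^sub>R u t) = 0}"

text \<open>Multiplication by a periodic function descends to an element of the centroid of the simple
  quotient, so it is either zero or injective.\<close>

lemma annihilator_or_injective:
  assumes f: "f \<in> periodic" and u: "u \<in> L" "\<psi> (\<lambda>t. f t *\<^sub>R u t) = 0"
  shows "f \<in> annihilator \<or> \<psi> u = 0"
proof -
  \<comment> \<open>The kernel of the action of \<open>f\<close> on the quotient, to be shown an
    ideal.\<close>
  let ?I = "{\<psi> u |u. u \<in> L \<and> \<psi> (\<lambda>t. f t *\<^sub>R u t) = 0}"
  have "module.subspace sc2 ?I"
  proof (rule subspaceI2)
    have "(\<lambda>_. 0) \<in> L" using L_const_scaleR[OF u(1), of 0] by simp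
    then show "0 \<in> ?I" using \<psi>_zero by force
  next
    fix x y assume "x \<in> ?I" "y \<in> ?I"
    then obtain v w where vw: "v \<in> L" "w \<in> L" "\<psi> (\<lambda>t. f t *\<^sub>R v t) = 0" "\<psi> (\<lambda>t. f t *\<^sub>R w t) = 0"
      "x = \<psi> v" "y = \<psi> w"
      by blast
    then have "\<psi> (\<lambda>t. f t *\<^sub>R (v t + w t)) = 0"
      using \<psi>_add[of "\<lambda>t. f t *\<^sub>R v t" "\<lambda>t. f t *\<^sub>R w t"] f by (simp add: L_scaleR scaleR_add_right)
    with vw show "x + y \<in> ?I"
      by (auto simp: \<psi>_add L_add intro!: exI[of _ "\<lambda>t. v t + w t"])
  next
    fix c x assume "x \<in> ?I"
    then obtain v where v: "v \<in> L" "\<psi> (\<lambda>t. f t *\<^sub>R v t) = 0" "x = \<psi> v"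
      by blast
    then have "\<psi> (\<lambda>t. f t *\<^sub>R sc1 c (v t)) = 0"
      using \<psi>_scale[of "\<lambda>t. f t *\<^sub>R v t" c] f
        linear_0[OF bounded_linear.linear[OF lie_bounded_linear_scale[OF lie2 real2]]]
      by (simp add: L_scaleR lie_scale_scaleR[OF lie1 real1])
    with v show "sc2 c x \<in> ?I"
      by (auto simp: \<psi>_scale L_scale intro!: exI[of _ "\<lambda>t. sc1 c (v t)"])
  qed
  moreover have "br2 y x \<in> ?I" if "x \<in> ?I" for x y
  proof -
    obtain v where v: "v \<in> L" "\<psi> (\<lambda>t. f t *\<^sub>R v t) = 0" "x = \<psi> v"
      using \<open>x \<in> ?I\<close> by blast
    obtain w where w: "w \<in> L" "\<psi> w = y" using \<psi>_surj by blast
    have "\<psi> (\<lambda>t. f t *\<^sub>R br1 (w t) (v t)) = \<psi> (\<lambda>t. br1 (w t) (f t *\<^sub>R v t))"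
      by (simp add: bounded_bilinear.scaleR_right[OF br1_bilinear])
    also have "\<dots> = 0"
      using v w f by (simp add: \<psi>_bracket L_scaleR bounded_bilinear.zero_right[OF br2_bilinear])
    finally show ?thesis
      using v w by (auto simp: \<psi>_bracket L_bracket intro!: exI[of _ "\<lambda>t. br1 (w t) (v t)"])
  qed
  ultimately have "?I = {0} \<or> ?I = UNIV"
    using simple by (simp add: simple_lie_def lie_ideal_def)
  then show ?thesis
  proof
    assume "?I = {0}"
    then show ?thesis using u by blast
  next
    assume univ: "?I = UNIV"
    have "\<psi> (\<lambda>t. f t *\<^sub>R v t) = 0" if v: "v \<in> L" for v
    proof -
      \<comment> \<open>Membership only yields some loop \<open>w\<close> with the same image as
        \<open>v\<close> that \<open>f\<close> sends into the kernel; the difference of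
        \<open>v\<close> and \<open>w\<close> is handled by stability of the kernel under
        \<open>f\<close>.\<close>
      have "\<psi> v \<in> ?I" using univ by simp
      then obtain w where w: "w \<in> L" "\<psi> (\<lambda>t. f t *\<^sub>R w t) = 0" "\<psi> v = \<psi> w" by blast
      have "\<psi> (\<lambda>t. f t *\<^sub>R (v t - w t)) = 0"
        using v w f by (intro kernel_periodic_submodule) (simp_all add: L_diff \<psi>_diff)
      then show ?thesis
        using \<psi>_diff[of "\<lambda>t. f t *\<^sub>R v t" "\<lambda>t. f t *\<^sub>R w t"] v w f
        by (simp add: L_scaleR scaleR_diff_right)
    qed
    then show ?thesis using f by (simp add: annihilator_def)
  qed
qed

section \<open>The annihilator as an ideal and its common zero\<close>

lemma annihilator_mult:
  assumes "f \<in> annihilator" "g \<in> periodic"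
  shows "(\<lambda>t. f t * g t) \<in> annihilator"
  using assms L_scaleR[OF assms(2)] unfolding annihilator_def
  by (auto simp: periodic_mult simp flip: scaleR_scaleR)

lemma annihilator_sum:
  assumes "finite I" "\<And>i. i \<in> I \<Longrightarrow> f i \<in> annihilator"
  shows "(\<lambda>t. \<Sum>i\<in>I. f i t) \<in> annihilator"
proof -
  have "\<psi> (\<lambda>t. (\<Sum>i\<in>I. f i t) *\<^sub>R u t) = 0" if "u \<in> L" for u
    using that assms(2) \<psi>_sum[of I "\<lambda>i t. f i t *\<^sub>R u t"]
    by (simp add: scaleR_sum_left annihilator_def L_scaleR)
  then show ?thesis
    using assms(2) by (auto simp: annihilator_def intro!: periodic_sum)
qed

lemma exists_nonzero: obtains u where "u \<in> L" "\<psi> u \<noteq> 0"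
proof -
  obtain x y where "br2 x y \<noteq> 0"
    using simple by (auto simp: simple_lie_def)
  then have "y \<noteq> 0"
    using bounded_bilinear.zero_right[OF br2_bilinear] by auto
  then show ?thesis using \<psi>_surj[of y] that by auto
qed

lemma one_notin_annihilator: "(\<lambda>_. 1) \<notin> annihilator"
  using exists_nonzero by (auto simp: annihilator_def)

text \<open>Without a common zero, compactness of one period gives finitely many members whose sum
  of squares vanishes nowhere. This sum is invertible among the periodic functions, so 1 would
  annihilate the nonzero quotient.\<close>

lemma annihilator_common_zero: "\<exists>p. \<forall>f\<in>annihilator. f p = 0"
proof (rule ccontr)
  assume "\<not> ?thesis"
  then have nz: "\<exists>f\<in>annihilator. f x \<noteq> 0" for x by blast
  have cont: "continuous_on UNIV f" if "f \<in> annihilator" for f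
  proof -
    have "diff_upto 1 UNIV f"
      using that by (auto simp: annihilator_def loop_alg_iff)
    then show ?thesis
      by (auto simp: diff_upto_def continuous_on_eq_continuous_at differentiable_imp_continuous_within)
  qed
  obtain C where C: "C \<subseteq> annihilator" "finite C" "{- pi..pi} \<subseteq> (\<Union>f\<in>C. {x. f x \<noteq> 0})"
  proof (rule compactE_image)
    show "open {x. f x \<noteq> 0}" if "f \<in> annihilator" for f
      by (intro open_Collect_neq cont that continuous_on_const)
    show "{- pi..pi} \<subseteq> (\<Union>f\<in>annihilator. {x. f x \<noteq> 0})"
      using nz by auto
  qed auto
  let ?F = "\<lambda>t. \<Sum>f\<in>C. f t * f t"
  have F: "?F \<in> annihilator"
    using C by (intro annihilator_sum annihilator_mult) (auto simp: annihilator_def)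
  have nzF: "?F t \<noteq> 0" for t
  proof -
    define s where "s = t - 2 * pi * of_int (winding 0 t)"
    have s: "s \<in> {- pi..pi}"
      using winding_eq_iff[of 0 t "winding 0 t"] by (auto simp: s_def)
    then obtain f where "f \<in> C" "f s \<noteq> 0" using C(3) by blast
    then have "?F s > 0"
      using C(2) by (intro sum_pos2[of C f]) (auto simp: less_le)
    moreover have "?F t = ?F s"
    proof -
      have "int_funpow (\<lambda>x. x) n x = (x :: real)" for n x
        by (simp add: int_funpow_def flip: id_def)
      then show ?thesis
        using loop_alg_shift[of "\<lambda>x. x" ?F s "winding 0 t"] F
        by (simp add: annihilator_def s_def flip: id_def)
    qed
    ultimately show ?thesis by simp
  qed
  have "(\<lambda>t. ?F t * inverse (?F t)) \<in> annihilator"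
    using F nzF by (intro annihilator_mult[OF F] periodic_inverse) (auto simp: annihilator_def)
  with nzF one_notin_annihilator show False by simp
qed

text \<open>The powers of \<open>f\<close> are linearly dependent modulo the annihilator because the quotient is finite
  dimensional; after splitting off the lowest power, the remaining factor does not vanish at \<open>p\<close>.\<close>

lemma vanishing_imp_annihilator:
  assumes zero: "\<And>g. g \<in> annihilator \<Longrightarrow> g p = 0" and f: "f \<in> periodic" "f p = 0"
  shows "f \<in> annihilator"
proof -
  obtain u where u: "u \<in> L" "\<psi> u \<noteq> 0" by (rule exists_nonzero)
  obtain a d where a: "\<exists>k\<le>d. a k \<noteq> 0" "(\<Sum>k\<le>d. a k *\<^sub>R \<psi> (\<lambda>t. f t ^ k *\<^sub>R u t)) = 0"
    by (rule exists_linear_relation)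
  note powL = L_scaleR[OF periodic_power[OF f(1)]]
  \<comment> \<open>The lowest exponent in the relation. Factoring out \<open>f ^ m\<close> leaves
    \<open>Q\<close>, whose value at \<open>p\<close> is the coefficient \<open>a m\<close> because
    \<open>f p = 0\<close>.\<close>
  define m where "m = (LEAST k. a k \<noteq> 0)"
  obtain k0 where k0: "k0 \<le> d" "a k0 \<noteq> 0" using a(1) by blast
  have m: "a m \<noteq> 0" "m \<le> d"
    unfolding m_def using LeastI[of "\<lambda>k. a k \<noteq> 0" k0] Least_le[of "\<lambda>k. a k \<noteq> 0" k0] k0 by auto
  have below_m: "a k = 0" if "k < m" for k
    using that not_less_Least unfolding m_def by blast
  define Q where "Q t = (\<Sum>k\<in>{m..d}. a k * f t ^ (k - m))" for t
  have Q: "Q \<in> periodic"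
    unfolding Q_def by (intro periodic_sum periodic_mult periodic_const periodic_power f)
  have "Q p = (\<Sum>k\<in>{m}. a k * f p ^ (k - m))"
    unfolding Q_def using m by (intro sum.mono_neutral_right) (auto simp: f(2))
  then have "Q \<notin> annihilator" using zero[of Q] m(1) by auto
  have "\<psi> (\<lambda>t. Q t *\<^sub>R (f t ^ m *\<^sub>R u t)) = \<psi> (\<lambda>t. \<Sum>k\<le>d. a k *\<^sub>R (f t ^ k *\<^sub>R u t))"
  proof -
    have "Q t * f t ^ m = (\<Sum>k\<le>d. a k * f t ^ k)" for t
    proof -
      have "Q t * f t ^ m = (\<Sum>k\<in>{m..d}. a k * f t ^ k)"
        unfolding Q_def sum_distrib_right by (intro sum.cong) (auto simp flip: power_add)
      also have "\<dots> = (\<Sum>k\<le>d. a k * f t ^ k)"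
        by (intro sum.mono_neutral_left) (auto simp: below_m)
      finally show ?thesis .
    qed
    then show ?thesis by (simp add: scaleR_sum_left)
  qed
  also have "\<dots> = (\<Sum>k\<le>d. a k *\<^sub>R \<psi> (\<lambda>t. f t ^ k *\<^sub>R u t))"
    using powL[OF u(1)] by (simp add: \<psi>_sum \<psi>_scaleR L_const_scaleR del: scaleR_scaleR)
  finally have "\<psi> (\<lambda>t. Q t *\<^sub>R (f t ^ m *\<^sub>R u t)) = 0" using a(2) by simp
  \<comment> \<open>Since \<open>Q\<close> is not in the annihilator it acts injectively and can be
    cancelled; the induction that follows strips the factors \<open>f\<close> one at a time.\<close>
  then have "\<psi> (\<lambda>t. f t ^ m *\<^sub>R u t) = 0"
    using annihilator_or_injective[OF Q powL[OF u(1)]] \<open>Q \<notin> annihilator\<close> by blast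
  then have "f \<in> annihilator \<or> \<psi> u = 0"
  proof (induction m)
    case (Suc m)
    then show ?case
      using annihilator_or_injective[OF f(1) powL[OF u(1), of m]] by auto
  qed simp
  with u show ?thesis by blast
qed

text \<open>A loop vanishing at \<open>p\<close> is, after multiplication by a squared cutoff, a
  combination of loops with periodic coefficients vanishing at \<open>p\<close>, and these
  coefficients annihilate.\<close>

lemma factors_through_evaluation: "\<exists>p. \<forall>u\<in>L. u p = 0 \<longrightarrow> \<psi> u = 0"
proof -
  obtain p where p0: "\<forall>g\<in>annihilator. g p = 0"
    using annihilator_common_zero by blast
  have ann: "f \<in> annihilator" if "f \<in> periodic" "f p = 0" for f
    by (rule vanishing_imp_annihilator[of p]) (use p0 that in auto)
  have "\<psi> u = 0" if u: "u \<in> L" "u p = 0" for u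
  proof -
    let ?J = "{p - pi..<p + pi}"
    have lin: "linear (\<lambda>x::real. x)" "bij (\<lambda>x::real. x)"
      using linear_id bij_id by (simp_all add: id_def)
    obtain e where e: "e \<in> periodic" "\<And>t. t \<in> ?J \<Longrightarrow> e t = bump (t - p)"
      by (rule loop_alg_bump[OF lin, of p 1]) auto
    \<comment> \<open>The coordinates of \<open>u\<close> are in general not periodic because of the
      twist, so they are cut off near \<open>p\<close> and then extended periodically. One factor
      \<open>bump\<close> goes into the coefficients \<open>f b\<close>, another into the loops
      \<open>w b\<close>.\<close>
    have "\<exists>f\<in>periodic. \<forall>t\<in>?J. f t = bump (t - p) * (u t \<bullet> b)" for b
    proof (rule twisted_extension[OF lin])
      show "diff_upto n UNIV (\<lambda>t. bump (t - p) * (u t \<bullet> b))" for n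
        using u(1) by (intro diff_upto_mult diff_upto_inner diff_upto_bump_shift) (auto simp: loop_alg_iff)
      show "bump (t - p) * (u t \<bullet> b) = 0" if "\<bar>t - p\<bar> \<ge> 2" for t
        using that by (simp add: bump_eq_0)
    qed blast
    then obtain f where f: "\<And>b. f b \<in> periodic" "\<And>b t. t \<in> ?J \<Longrightarrow> f b t = bump (t - p) * (u t \<bullet> b)"
      by metis
    have "\<exists>w\<in>L. \<forall>t\<in>?J. w t = bump (t - p) *\<^sub>R b" for b
      using loop_alg_bump[OF linear_\<sigma> bij_\<sigma>] by metis
    then obtain w where w: "\<And>b. w b \<in> L" "\<And>b t. t \<in> ?J \<Longrightarrow> w b t = bump (t - p) *\<^sub>R b"
      by metis
    have p: "p \<in> ?J" by simp
    have e2: "(\<lambda>t. e t * e t) \<in> periodic" by (intro periodic_mult e)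
    have "(\<lambda>t. (e t * e t) *\<^sub>R u t) = (\<lambda>t. \<Sum>b\<in>Basis. f b t *\<^sub>R w b t)"
    proof (rule loop_alg_eqI[OF bij_\<sigma>])
      fix t assume t: "t \<in> ?J"
      have "(\<Sum>b\<in>Basis. f b t *\<^sub>R w b t) = (\<Sum>b\<in>Basis. (e t * e t) *\<^sub>R (u t \<bullet> b) *\<^sub>R b)"
        using t by (intro sum.cong) (auto simp: f w e algebra_simps)
      also have "\<dots> = (e t * e t) *\<^sub>R u t"
        by (simp only: scaleR_sum_right[symmetric] euclidean_representation)
      finally show "(e t * e t) *\<^sub>R u t = (\<Sum>b\<in>Basis. f b t *\<^sub>R w b t)" ..
    qed (use e2 u f w in \<open>auto intro!: L_scaleR loop_alg_sum[OF linear_\<sigma>]\<close>)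
    moreover have "f b \<in> annihilator" for b
      using f(2)[OF p, of b] u(2) by (intro ann[OF f(1)]) simp
    then have "\<psi> (\<lambda>t. \<Sum>b\<in>Basis. f b t *\<^sub>R w b t) = 0"
      using f w by (subst \<psi>_sum) (auto simp: annihilator_def intro!: L_scaleR)
    ultimately have 1: "\<psi> (\<lambda>t. (e t * e t) *\<^sub>R u t) = 0" by simp
    let ?c = "bump 0 * bump 0"
    \<comment> \<open>The squared cutoff minus its value at \<open>p\<close> vanishes at
      \<open>p\<close>, so on the quotient the cutoff acts as the nonzero scalar
      \<open>?c\<close>.\<close>
    have "(\<lambda>t. e t * e t + (- ?c)) \<in> annihilator"
      using e(2)[OF p] by (intro ann periodic_add e2 periodic_const) auto
    then have "\<psi> (\<lambda>t. (e t * e t) *\<^sub>R u t - ?c *\<^sub>R u t) = 0"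
      using u by (simp add: annihilator_def scaleR_diff_left)
    then have "?c *\<^sub>R \<psi> u = 0"
      using \<psi>_diff[OF L_scaleR[OF e2 u(1)] L_const_scaleR[OF u(1), of ?c]] 1 \<psi>_scaleR[OF u(1), of ?c]
      by simp
    then show ?thesis using bump_pos[of 0] by simp
  qed
  then show ?thesis by blast
qed

end

section \<open>Surjective homomorphisms\<close>

theorem surjective_loop_hom_standard:
  fixes sc1 :: "'k::field \<Rightarrow> 'a::euclidean_space \<Rightarrow> 'a" and sc2 :: "'k \<Rightarrow> 'b::euclidean_space \<Rightarrow> 'b"
  assumes real1: "\<And>r x. sc1 (\<rho> r) x = r *\<^sub>R x" and real2: "\<And>r y. sc2 (\<rho> r) y = r *\<^sub>R y"
    and lie1: "lie_algebra sc1 br1" and lie2: "lie_algebra sc2 br2" and simple: "simple_lie sc2 br2"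
    and aut1: "lie_aut sc1 br1 \<sigma>1" and aut2: "lie_aut sc2 br2 \<sigma>2"
    and hom: "loop_hom sc1 br1 \<sigma>1 sc2 br2 \<sigma>2 \<phi>" and surj: "\<phi> ` loop_alg \<sigma>1 = loop_alg \<sigma>2"
  shows "standard_hom sc1 br1 \<sigma>1 sc2 br2 \<phi>"
proof -
  let ?L = "loop_alg \<sigma>1"
  have hom_in: "\<phi> u \<in> loop_alg \<sigma>2"
    and hom_add: "\<phi> (\<lambda>t. u t + v t) t = \<phi> u t + \<phi> v t"
    and hom_scale: "\<phi> (\<lambda>t. sc1 c (u t)) t = sc2 c (\<phi> u t)"
    and hom_bracket: "\<phi> (\<lambda>t. br1 (u t) (v t)) t = br2 (\<phi> u t) (\<phi> v t)"
    if "u \<in> ?L" "v \<in> ?L" for u v c t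
    using hom that by (auto simp: loop_hom_def)
  have \<sigma>2: "linear \<sigma>2" "bij \<sigma>2"
    using lie_hom_linear[of sc2 br2 sc2 br2 \<sigma>2] aut2 real2 by (auto simp: lie_aut_def)
  have eval_surj: "\<exists>u\<in>?L. \<phi> u t = y" for t y
  proof -
    obtain v where v: "v \<in> loop_alg \<sigma>2" "\<And>s. s \<in> {t - pi..<t + pi} \<Longrightarrow> v s = bump (s - t) *\<^sub>R (inverse (bump 0) *\<^sub>R y)"
      using loop_alg_bump[OF \<sigma>2] by metis
    then have "v t = y" using bump_pos[of 0] by simp
    then show ?thesis using v(1) unfolding surj[symmetric] by auto
  qed
  have quotient: "loop_quotient sc1 br1 \<sigma>1 sc2 br2 \<rho> (\<lambda>u. \<phi> u t)" for t
    by unfold_locales (use assms eval_surj in \<open>auto simp: hom_add hom_scale hom_bracket\<close>)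
  interpret Q: loop_quotient sc1 br1 \<sigma>1 sc2 br2 \<rho> "\<lambda>u. \<phi> u t" for t
    by (rule quotient)
  \<comment> \<open>A pointwise choice of evaluation points, without any regularity so far.\<close>
  obtain l where l: "\<And>t u. u \<in> ?L \<Longrightarrow> u (l t) = 0 \<Longrightarrow> \<phi> u t = 0"
    using loop_quotient.factors_through_evaluation[OF quotient] by metis
  have mult: "\<phi> (\<lambda>t. f t *\<^sub>R u t) t = f (l t) *\<^sub>R \<phi> u t" if "f \<in> periodic" "u \<in> ?L" for f u t
  proof -
    have fu: "(\<lambda>s. f s *\<^sub>R u s) \<in> ?L" "(\<lambda>s. f (l t) *\<^sub>R u s) \<in> ?L"
      using that by (auto intro: Q.L_scaleR Q.L_const_scaleR)
    have "\<phi> (\<lambda>s. f s *\<^sub>R u s - f (l t) *\<^sub>R u s) t = 0"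
      using fu by (intro l Q.L_diff) auto
    then show ?thesis
      using Q.\<psi>_diff[OF fu] Q.\<psi>_scaleR[OF that(2)] by simp
  qed
  \<comment> \<open>Near \<open>t0\<close>, \<open>f (l t)\<close> is the quotient of two smooth
    functions, obtained by pairing \<open>mult\<close> with the fixed vector
    \<open>\<phi> u t0\<close> for a loop \<open>u\<close> whose image does not vanish at
    \<open>t0\<close>.\<close>
  have smooth_l: "smooth_fun (\<lambda>t. f (l t))" if f: "f \<in> periodic" for f
  proof -
    have "\<exists>T. t0 \<in> T \<and> diff_upto n T (\<lambda>t. f (l t))" for t0 n
    proof -
      obtain u where u: "u \<in> ?L" "\<phi> u t0 \<noteq> 0" using Q.exists_nonzero by blast
      define p where "p t = \<phi> u t \<bullet> \<phi> u t0" for t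
      define q where "q t = \<phi> (\<lambda>t. f t *\<^sub>R u t) t \<bullet> \<phi> u t0" for t
      have pq: "diff_upto k UNIV p" "diff_upto k UNIV q" for k
        using hom_in[OF u(1) u(1)] hom_in[OF Q.L_scaleR[OF f u(1)] u(1)]
        unfolding p_def q_def by (auto simp: loop_alg_iff intro!: diff_upto_inner)
      have "isCont p t" for t
        using pq(1)[of 1] by (auto simp: diff_upto_def differentiable_imp_continuous_within)
      then have op: "open {t. p t \<noteq> 0}"
        by (intro open_Collect_neq continuous_on_const) (auto simp: continuous_on_eq_continuous_at)
      have "diff_upto n {t. p t \<noteq> 0} (\<lambda>t. q t * inverse (p t))"
        by (intro diff_upto_mult diff_upto_inverse op)
           (auto intro: diff_upto_mono[OF pq(1)[of n]] diff_upto_mono[OF pq(2)[of n]])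
      then have "diff_upto n {t. p t \<noteq> 0} (\<lambda>t. f (l t))"
        by (rule diff_upto_cong[OF op, rotated]) (simp add: p_def q_def mult[OF f u(1)])
      moreover have "p t0 \<noteq> 0" using u by (simp add: p_def)
      ultimately show ?thesis by (intro exI[of _ "{t. p t \<noteq> 0}"]) simp
    qed
    then show ?thesis
      unfolding smooth_fun_iff_diff_upto by (intro allI diff_upto_local)
  qed
  have "smooth_fun (\<lambda>t. cos (l t))" "smooth_fun (\<lambda>t. sin (l t))"
    using diff_upto_sin_cos by (auto intro!: smooth_l simp: loop_alg_iff)
  then obtain \<theta> where \<theta>: "smooth_fun \<theta>" "\<And>t. cos (\<theta> t) = cos (l t)" "\<And>t. sin (\<theta> t) = sin (l t)"
    by (rule smooth_angle_lift) auto
  \<comment> \<open>The points \<open>\<theta> t\<close> and \<open>l t\<close> differ by whole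
    periods, and the iterates of the twist are linear, so vanishing at one is passed on to the
    other.\<close>
  have ker: "\<phi> u t = 0" if "u \<in> ?L" "u (\<theta> t) = 0" for u t
  proof (rule l[OF that(1)])
    obtain n :: int where "l t = \<theta> t + 2 * pi * n"
      using sin_cos_eq_iff[of "l t" "\<theta> t"] \<theta> by auto
    then show "u (l t) = 0"
      using loop_alg_shift[OF Q.bij_\<sigma> that(1), of "\<theta> t" n] that(2)
        linear_0[OF bounded_linear.linear[OF bounded_linear_int_funpow[OF Q.linear_\<sigma> Q.bij_\<sigma>]]]
      by simp
  qed
  have "\<exists>w\<in>?L. \<forall>s\<in>{a - pi..<a + pi}. w s = bump (s - a) *\<^sub>R x" for a x
    using loop_alg_bump[OF Q.linear_\<sigma> Q.bij_\<sigma>] by metis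
  then obtain w where w: "\<And>a x. w a x \<in> ?L"
    "\<And>a x s. s \<in> {a - pi..<a + pi} \<Longrightarrow> w a x s = bump (s - a) *\<^sub>R x"
    by metis
  \<comment> \<open>The loop used here takes the value \<open>x\<close> at
    \<open>\<theta> t\<close>; by \<open>ker\<close>, any other loop with this value has the same
    image at time \<open>t\<close>.\<close>
  define \<Phi> where "\<Phi> t x = \<phi> (w (\<theta> t) (inverse (bump 0) *\<^sub>R x)) t" for t x
  have \<Phi>: "\<phi> u t = \<Phi> t (u (\<theta> t))" if u: "u \<in> ?L" for u t
  proof -
    let ?w = "w (\<theta> t) (inverse (bump 0) *\<^sub>R u (\<theta> t))"
    have "\<phi> (\<lambda>s. u s - ?w s) t = 0"
      using bump_pos[of 0] u w by (intro ker Q.L_diff) auto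
    then show ?thesis
      using Q.\<psi>_diff[OF u w(1)] by (simp add: \<Phi>_def)
  qed
  have through: "\<exists>u\<in>?L. u (\<theta> t) = x" for t x
    using w(1)[of "\<theta> t" "inverse (bump 0) *\<^sub>R x"] w(2)[of "\<theta> t" "\<theta> t" "inverse (bump 0) *\<^sub>R x"] bump_pos[of 0]
    by force
  have "lie_hom sc1 br1 sc2 br2 (\<Phi> t)" for t
  proof -
    have "\<Phi> t (x + y) = \<Phi> t x + \<Phi> t y \<and> \<Phi> t (br1 x y) = br2 (\<Phi> t x) (\<Phi> t y) \<and> \<Phi> t (sc1 c x) = sc2 c (\<Phi> t x)" for x y c
    proof -
      obtain u v where uv: "u \<in> ?L" "u (\<theta> t) = x" "v \<in> ?L" "v (\<theta> t) = y"
        using through by metis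
      show ?thesis
        using \<Phi>[OF Q.L_add[OF uv(1,3)], of t] \<Phi>[OF Q.L_bracket[OF uv(1,3)], of t]
          \<Phi>[OF Q.L_scale[OF uv(1)], of c t] \<Phi>[OF uv(1), of t] \<Phi>[OF uv(3), of t] uv
        by (simp add: hom_add hom_scale hom_bracket)
    qed
    then show ?thesis
      using lie1 lie2 by (auto simp: lie_hom_def Vector_Spaces.linear_iff lie_algebra_def)
  qed
  moreover have "smooth_fun (\<lambda>t. \<Phi> t x)" for x
  proof -
    have "\<exists>T. t0 \<in> T \<and> diff_upto n T (\<lambda>t. \<Phi> t x)" for t0 n
    proof -
      \<comment> \<open>The loops defining \<open>\<Phi> t x\<close> vary with \<open>t\<close>, so
        one fixed loop is used near \<open>t0\<close>. At \<open>\<theta> t\<close> it equals a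
        scalar multiple of \<open>x\<close>, and the scalar is positive on \<open>?T\<close>, where
        \<open>\<theta>\<close> stays within distance 1 of \<open>\<theta> t0\<close>.\<close>
      let ?u = "w (\<theta> t0) x"
      let ?T = "\<theta> -` {\<theta> t0 - 1<..<\<theta> t0 + 1}"
      have th: "diff_upto k UNIV \<theta>" for k
        using \<theta>(1) by (simp add: smooth_fun_iff_diff_upto)
      have "isCont \<theta> t" for t
        using th[of 1] by (auto simp: diff_upto_def differentiable_imp_continuous_within)
      then have op: "open ?T"
        by (intro open_vimage) (auto simp: continuous_on_eq_continuous_at)
      have "diff_upto n UNIV (\<lambda>t. bump (\<theta> t - \<theta> t0))"
        using diff_upto_compose[OF open_UNIV open_UNIV _ diff_upto_bump_shift th] by simp
      then have "diff_upto n ?T (\<lambda>t. inverse (bump (\<theta> t - \<theta> t0)))"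
        by (intro diff_upto_inverse op less_imp_neq[OF bump_pos, symmetric]) (auto elim: diff_upto_mono)
      moreover have "diff_upto n ?T (\<phi> ?u)"
        using hom_in[OF w(1) w(1)] by (auto simp: loop_alg_iff intro: diff_upto_mono)
      ultimately have "diff_upto n ?T (\<lambda>t. inverse (bump (\<theta> t - \<theta> t0)) *\<^sub>R \<phi> ?u t)"
        by (intro diff_upto_scaleR op)
      then have "diff_upto n ?T (\<lambda>t. \<Phi> t x)"
      proof (rule diff_upto_cong[OF op, rotated])
        fix t assume t: "t \<in> ?T"
        let ?c = "bump (\<theta> t - \<theta> t0)"
        have c: "?c > 0" using t by (intro bump_pos) auto
        have "(\<lambda>s. inverse ?c *\<^sub>R ?u s) \<in> ?L"
          by (intro Q.L_const_scaleR w)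
        moreover have "?u (\<theta> t) = ?c *\<^sub>R x"
          using t pi_gt3 by (intro w) auto
        ultimately show "inverse ?c *\<^sub>R \<phi> ?u t = \<Phi> t x"
          using \<Phi>[of "\<lambda>s. inverse ?c *\<^sub>R ?u s" t] Q.\<psi>_scaleR[OF w(1)] c by simp
      qed
      then show ?thesis by (intro exI[of _ ?T]) auto
    qed
    then show ?thesis
      unfolding smooth_fun_iff_diff_upto by (intro allI diff_upto_local)
  qed
  ultimately show ?thesis
    unfolding standard_hom_def using \<theta>(1) \<Phi> by blast
qed

text \<open>The conjuncts are the real and the complex case. A finite dimensional complex space is
  encoded as a Euclidean space with a complex scalar multiplication extending \<open>scaleR\<close>,
  so that smoothness refers to the real norm.\<close>

theorem theorem2p9:
  shows
  "(\<forall>(br1 :: 'a::euclidean_space \<Rightarrow> 'a \<Rightarrow> 'a) \<sigma>1 (br2 :: 'b::euclidean_space \<Rightarrow> 'b \<Rightarrow> 'b) \<sigma>2 \<phi>.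
      lie_algebra scaleR br1 \<and> lie_algebra scaleR br2 \<and> simple_lie scaleR br2
      \<and> lie_aut scaleR br1 \<sigma>1 \<and> lie_aut scaleR br2 \<sigma>2
      \<and> loop_hom scaleR br1 \<sigma>1 scaleR br2 \<sigma>2 \<phi>
      \<and> \<phi> ` loop_alg \<sigma>1 = loop_alg \<sigma>2
      \<longrightarrow> standard_hom scaleR br1 \<sigma>1 scaleR br2 \<phi>)
 \<and> (\<forall>(sc1 :: complex \<Rightarrow> 'c::euclidean_space \<Rightarrow> 'c) (br1 :: 'c \<Rightarrow> 'c \<Rightarrow> 'c) \<sigma>1
      (sc2 :: complex \<Rightarrow> 'd::euclidean_space \<Rightarrow> 'd) (br2 :: 'd \<Rightarrow> 'd \<Rightarrow> 'd) \<sigma>2 \<phi>.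
      (\<forall>r x. sc1 (complex_of_real r) x = r *\<^sub>R x)
      \<and> (\<forall>r y. sc2 (complex_of_real r) y = r *\<^sub>R y)
      \<and> lie_algebra sc1 br1 \<and> lie_algebra sc2 br2 \<and> simple_lie sc2 br2
      \<and> lie_aut sc1 br1 \<sigma>1 \<and> lie_aut sc2 br2 \<sigma>2
      \<and> loop_hom sc1 br1 \<sigma>1 sc2 br2 \<sigma>2 \<phi>
      \<and> \<phi> ` loop_alg \<sigma>1 = loop_alg \<sigma>2
      \<longrightarrow> standard_hom sc1 br1 \<sigma>1 sc2 br2 \<phi>)"
proof (intro conjI allI impI)
  fix br1 :: "'a \<Rightarrow> 'a \<Rightarrow> 'a" and \<sigma>1 and br2 :: "'b \<Rightarrow> 'b \<Rightarrow> 'b" and \<sigma>2 \<phi>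
  assume "lie_algebra scaleR br1 \<and> lie_algebra scaleR br2 \<and> simple_lie scaleR br2
      \<and> lie_aut scaleR br1 \<sigma>1 \<and> lie_aut scaleR br2 \<sigma>2
      \<and> loop_hom scaleR br1 \<sigma>1 scaleR br2 \<sigma>2 \<phi>
      \<and> \<phi> ` loop_alg \<sigma>1 = loop_alg \<sigma>2"
  then show "standard_hom scaleR br1 \<sigma>1 scaleR br2 \<phi>"
    by (intro surjective_loop_hom_standard[where \<rho> = "\<lambda>r. r"]) auto
next
  fix sc1 :: "complex \<Rightarrow> 'c \<Rightarrow> 'c" and br1 \<sigma>1 and sc2 :: "complex \<Rightarrow> 'd \<Rightarrow> 'd" and br2 \<sigma>2 \<phi>
  assume "(\<forall>r x. sc1 (complex_of_real r) x = r *\<^sub>R x)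
      \<and> (\<forall>r y. sc2 (complex_of_real r) y = r *\<^sub>R y)
      \<and> lie_algebra sc1 br1 \<and> lie_algebra sc2 br2 \<and> simple_lie sc2 br2
      \<and> lie_aut sc1 br1 \<sigma>1 \<and> lie_aut sc2 br2 \<sigma>2
      \<and> loop_hom sc1 br1 \<sigma>1 sc2 br2 \<sigma>2 \<phi>
      \<and> \<phi> ` loop_alg \<sigma>1 = loop_alg \<sigma>2"
  then show "standard_hom sc1 br1 \<sigma>1 sc2 br2 \<phi>"
    by (intro surjective_loop_hom_standard[where \<rho> = complex_of_real]) auto
qed

end
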